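(* For integers $n\ge 1$ and $k\ge 0$, let $X_n(k)$ denote the number of vertices of the random graph $G_1^n$ whose second degree equals $k$, and let $M_n^2(k)=\mathbb{E}\,X_n(k)$. For any $\varepsilon>0$ there exists a function $\varphi(n)=o(n)$ (as $n\to\infty$) such that $$\lim_{n\to\infty}\mathrm{P}\left(|X_n(k)-M_n^2(k)|\ge\frac{\varphi(n)}{k^2}\right)=0$$ for any $1\le k\le n^{1/6-\varepsilon}$, where $k$ is an integer that may depend on $n$. That is, $\max_{k}\mathrm{P}\left(|X_n(k)-M_n^2(k)|\ge \varphi(n)/k^2\right)\to 0$ as $n\to\infty$, the maximum being over all integers $k$ with $1\le k\le n^{1/6-\varepsilon}$ (and taken to be $0$ if there are none).
   Context: The Bollob\'as--Riordan random graph $G_1^n$ (case $m=1$) on the vertex set $\{1,\dots,n\}$ is constructed inductively. $G_1^1$ is the graph with one vertex $1$ and one loop at it. Given $G_1^{t-1}$ ($t\ge 2$), the graph $G_1^t$ is obtained by adding the vertex $t$ and one edge between $t$ and $i$, where $i\in\{1,\dots,t\}$ is chosen randomly (conditionally on $G_1^{t-1}$) with $$\mathrm{P}(i=s)=\begin{cases} d_{G_1^{t-1}}(s)/(2t-1), & 1\le s\le t-1,\\ 1/(2t-1), & s=t.\end{cases}$$ Here $d_{G}(s)$ is the degree of the vertex $s$ in $G$; a loop contributes $2$ to the degree. If $i=t$ the new edge is a loop at $t$. For a vertex $t\in G_1^n$ the second degree of $t$ is $$d_2(t)=\#\{ij : i\neq t,\ j\neq t,\ it\in G_1^n,\ ij\in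 G_1^n\},$$ i.e. the number of edges adjacent to the neighbors of $t$, except for the edges adjacent to $t$. A loop at a neighbor $i\ne t$ of $t$ contributes $2$ to $d_2(t)$, just as it contributes $2$ to the degree of $i$. (In $G_1^n$ every non-loop edge joins a vertex to an earlier one and each vertex emits one edge, so there are no multiple edges and no non-loop edges between two neighbors of $t$. Thus $d_2(t)=\sum_{i}(d_{G_1^n}(i)-1)$, the sum being over all vertices $i\ne t$ adjacent to $t$.) *)

theory Defs
  imports "HOL-Probability.Probability" "HOL-Library.Landau_Symbols"
begin

text \<open>
  A graph on \<open>{1..n}\<close> is given by its set of edges; an edge between \<open>i\<close> and \<open>j\<close> is the set \<open>{i, j}\<close>,
  so a loop at \<open>i\<close> is the singleton \<open>{i}\<close>. A set (rather than a multiset) of edges suffices: the edge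
  added together with vertex \<open>t\<close> contains \<open>t\<close>, so it never coincides with an earlier edge.
\<close>

type_synonym graph = "nat set set"

definition vdegree :: "graph \<Rightarrow> nat \<Rightarrow> nat" where
  "vdegree E s = card {e \<in> E. s \<in> e} + card {e \<in> E. e = {s}}"

text \<open>
  The edges adjacent to the neighbours of \<open>t\<close> but not to \<open>t\<close>; loops (\<open>card e = 1\<close>) count twice.
\<close>

definition second_degree :: "graph \<Rightarrow> nat \<Rightarrow> nat" where
  "second_degree E t =
     (\<Sum>e | e \<in> E \<and> t \<notin> e \<and> (\<exists>i\<in>e. i \<noteq> t \<and> {i, t} \<in> E). if card e = 1 then 2 else 1)"

text \<open>
  The function below is a probability mass function only if the degrees of \<open>E\<close> on \<open>{1..t-1}\<close> sum to
  \<open>2 * (t - 1)\<close>. Lemmas \<open>G1_recursive_graph\<close> and \<open>pmf_attach\<close> show that this is the case wherever it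
  is used.
\<close>

definition attach :: "nat \<Rightarrow> graph \<Rightarrow> nat pmf" where
  "attach t E = embed_pmf (\<lambda>s.
     if 1 \<le> s \<and> s < t then real (vdegree E s) / (2 * real t - 1)
     else if s = t then 1 / (2 * real t - 1)
     else 0)"

text \<open>The value at \<open>0\<close> is a dummy.\<close>

fun G1 :: "nat \<Rightarrow> graph pmf" where
  "G1 0 = return_pmf {}"
| "G1 (Suc 0) = return_pmf {{1}}"
| "G1 (Suc (Suc m)) =
     bind_pmf (G1 (Suc m)) (\<lambda>E.
     map_pmf (\<lambda>i. insert {Suc (Suc m), i} E) (attach (Suc (Suc m)) E))"

definition X :: "nat \<Rightarrow> nat \<Rightarrow> graph \<Rightarrow> nat" where
  "X n k E = card {t \<in> {1..n}. second_degree E t = k}"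

definition M2 :: "nat \<Rightarrow> nat \<Rightarrow> real" where
  "M2 n k = measure_pmf.expectation (G1 n) (\<lambda>E. real (X n k E))"


subsection \<open>Adequacy of the definitions\<close>

definition recursive_graph :: "nat \<Rightarrow> graph \<Rightarrow> bool" where
  "recursive_graph n E \<longleftrightarrow>
     (\<exists>f. (\<forall>t\<in>{1..n}. f t \<in> {1..t}) \<and> E = (\<lambda>t. {t, f t}) ` {1..n})"

lemma recursive_graph_finite: "recursive_graph n E \<Longrightarrow> finite E"
  by (auto simp: recursive_graph_def)

lemma recursive_graph_subset: "recursive_graph n E \<Longrightarrow> e \<in> E \<Longrightarrow> e \<subseteq> {1..n}"
  unfolding recursive_graph_def by fastforce

lemma recursive_graph_insert:
  assumes "recursive_graph n E" "i \<in> {1..Suc n}"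
  shows "recursive_graph (Suc n) (insert {Suc n, i} E)"
proof -
  from assms(1) obtain f where f: "\<forall>t\<in>{1..n}. f t \<in> {1..t}" "E = (\<lambda>t. {t, f t}) ` {1..n}"
    unfolding recursive_graph_def by blast
  have "insert {Suc n, i} E = (\<lambda>t. {t, (f(Suc n := i)) t}) ` {1..Suc n}"
    by (auto simp: f(2) atLeastAtMostSuc_conv)
  moreover have "\<forall>t\<in>{1..Suc n}. (f(Suc n := i)) t \<in> {1..t}"
    using f(1) assms(2) by (auto simp: atLeastAtMostSuc_conv)
  ultimately show ?thesis unfolding recursive_graph_def by blast
qed

lemma vdegree_insert:
  assumes "finite E" "{t, i} \<notin> E"
  shows "vdegree (insert {t, i} E) s = vdegree E s + (if s = t then 1 else 0) + (if s = i then 1 else 0)"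
proof -
  have 1: "{e \<in> insert {t, i} E. s \<in> e} =
      (if s = t \<or> s = i then insert {t, i} {e \<in> E. s \<in> e} else {e \<in> E. s \<in> e})" by auto
  have 2: "{e \<in> insert {t, i} E. e = {s}} =
      (if s = t \<and> s = i then insert {t, i} {e \<in> E. e = {s}} else {e \<in> E. e = {s}})" by auto
  show ?thesis unfolding vdegree_def 1 2 using assms by (auto simp: card_insert_if)
qed

lemma sum_vdegree:
  assumes "recursive_graph n E"
  shows "(\<Sum>s = 1..n. vdegree E s) = 2 * n"
  using assms
proof (induction n arbitrary: E)
  case 0
  then show ?case by simp
next
  case (Suc n)
  from Suc.prems obtain f where f: "\<forall>t\<in>{1..Suc n}. f t \<in> {1..t}" "E = (\<lambda>t. {t, f t}) ` {1..Suc n}"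
    unfolding recursive_graph_def by blast
  define E' where "E' = (\<lambda>t. {t, f t}) ` {1..n}"
  have rec: "recursive_graph n E'"
    unfolding recursive_graph_def E'_def using f(1) by (intro exI[of _ f]) auto
  have E: "E = insert {Suc n, f (Suc n)} E'"
    by (auto simp: f(2) E'_def atLeastAtMostSuc_conv)
  have new: "{Suc n, f (Suc n)} \<notin> E'" using recursive_graph_subset[OF rec] by fastforce
  have "{e \<in> E'. Suc n \<in> e} = {}" "{e \<in> E'. e = {Suc n}} = {}"
    using recursive_graph_subset[OF rec] by fastforce+
  then have d0: "vdegree E' (Suc n) = 0" by (simp only: vdegree_def card.empty)
  have fi: "f (Suc n) \<in> {1..Suc n}" using f(1) by auto
  have "(\<Sum>s = 1..Suc n. vdegree E s) = (\<Sum>s = 1..Suc n. vdegree E' s)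
      + (\<Sum>s = 1..Suc n. if s = Suc n then 1 else 0) + (\<Sum>s = 1..Suc n. if s = f (Suc n) then 1 else 0)"
    unfolding E vdegree_insert[OF recursive_graph_finite[OF rec] new] by (simp add: sum.distrib)
  also have "\<dots> = 2 * Suc n" using Suc.IH[OF rec] d0 fi by (simp add: sum.delta)
  finally show ?case .
qed

lemma pmf_attach:
  assumes "recursive_graph n E"
  shows "pmf (attach (Suc n) E) s =
    (if 1 \<le> s \<and> s < Suc n then real (vdegree E s) / (2 * real (Suc n) - 1)
     else if s = Suc n then 1 / (2 * real (Suc n) - 1) else 0)" (is "_ = ?p s")
  unfolding attach_def
proof (rule pmf_embed_pmf)
  show "0 \<le> ?p s" for s by simp
  have "(\<integral>\<^sup>+ s. ennreal (?p s) \<partial>count_space UNIV) = (\<Sum>s\<in>{1..Suc n}. ennreal (?p s))"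
    by (rule nn_integral_count_space') (auto split: if_splits)
  also have "\<dots> = ennreal (\<Sum>s = 1..Suc n. ?p s)" by (subst sum_ennreal) auto
  also have "(\<Sum>s = 1..Suc n. ?p s) = (\<Sum>s = 1..n. real (vdegree E s) / (2 * real (Suc n) - 1))
      + 1 / (2 * real (Suc n) - 1)" by simp
  also have "\<dots> = (real (\<Sum>s = 1..n. vdegree E s) + 1) / (2 * real (Suc n) - 1)"
    by (simp add: sum_divide_distrib add_divide_distrib)
  also have "\<dots> = 1" unfolding sum_vdegree[OF assms] by simp
  finally show "(\<integral>\<^sup>+ s. ennreal (?p s) \<partial>count_space UNIV) = 1" by simp
qed

lemma set_pmf_attach:
  assumes "recursive_graph n E"
  shows "set_pmf (attach (Suc n) E) \<subseteq> {1..Suc n}"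
  using pmf_attach[OF assms] by (auto simp: set_pmf_iff split: if_splits)

lemma G1_recursive_graph: "E \<in> set_pmf (G1 n) \<Longrightarrow> recursive_graph n E"
proof (induction n arbitrary: E rule: G1.induct)
  case (3 m)
  from "3.prems" obtain E' i where E': "E' \<in> set_pmf (G1 (Suc m))"
    and i: "i \<in> set_pmf (attach (Suc (Suc m)) E')" and E: "E = insert {Suc (Suc m), i} E'"
    by auto
  have rec: "recursive_graph (Suc m) E'" by (rule "3.IH"[OF E'])
  with i have "i \<in> {1..Suc (Suc m)}" using set_pmf_attach by blast
  with rec show ?case unfolding E by (rule recursive_graph_insert)
qed (auto simp: recursive_graph_def)

lemma vdegree_alt:
  assumes "finite E"
  shows "vdegree E s = (\<Sum>e | e \<in> E \<and> s \<in> e. if card e = 1 then 2 else 1)"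
proof -
  have "{e \<in> E. e = {s}} = {e \<in> {e \<in> E. s \<in> e}. card e = 1}"
    by (auto simp: card_1_singleton_iff)
  moreover have "finite {e \<in> E. s \<in> e}" using assms by simp
  from sum.inter_filter[OF this, of "\<lambda>_. 1 :: nat" "\<lambda>e. card e = 1"]
  have "card {e \<in> {e \<in> E. s \<in> e}. card e = 1} = (\<Sum>e\<in>{e \<in> E. s \<in> e}. if card e = 1 then 1 else 0)"
    by (rule trans[OF card_eq_sum])
  ultimately have loops: "card {e \<in> E. e = {s}} = (\<Sum>e\<in>{e \<in> E. s \<in> e}. if card e = 1 then 1 else 0)"
    by (rule ssubst[of _ _ "\<lambda>A. card A = _"])
  have "vdegree E s = (\<Sum>e\<in>{e \<in> E. s \<in> e}. 1 + (if card e = 1 then 1 else 0))"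
    unfolding sum.distrib loops[symmetric] vdegree_def by (rule arg_cong2[OF card_eq_sum refl])
  also have "\<dots> = (\<Sum>e | e \<in> E \<and> s \<in> e. if card e = 1 then 2 else 1)"
    by (rule sum.cong) simp_all
  finally show ?thesis .
qed

lemma recursive_graph_no_triangle:
  assumes "recursive_graph n E" "{i, t} \<in> E" "{j, t} \<in> E" "{i, j} \<in> E" "i \<noteq> t" "j \<noteq> t"
  shows "i = j"
proof -
  from assms(1) obtain f where f: "\<forall>t\<in>{1..n}. f t \<in> {1..t}" "E = (\<lambda>t. {t, f t}) ` {1..n}"
    unfolding recursive_graph_def by blast
  have *: "(a < b \<and> f b = a) \<or> (b < a \<and> f a = b)" if ab: "{a, b} \<in> E" "a \<noteq> b" for a b
  proof -
    obtain t where t: "t \<in> {1..n}" "{a, b} = {t, f t}" using ab(1) f(2) by auto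
    have "f t \<le> t" using f(1) t(1) by auto
    with t(2) ab(2) show ?thesis by (auto simp: doubleton_eq_iff)
  qed
  show ?thesis
  proof (rule ccontr)
    assume "i \<noteq> j"
    with *[OF assms(2,5)] *[OF assms(3,6)] *[OF assms(4)] show False by auto
  qed
qed

lemma second_degree_alt:
  assumes "E \<in> set_pmf (G1 n)"
  shows "second_degree E t = (\<Sum>i | i \<noteq> t \<and> {i, t} \<in> E. vdegree E i - 1)"
proof -
  let ?w = "\<lambda>e :: nat set. if card e = 1 then 2 else 1 :: nat"
  let ?N = "{i. i \<noteq> t \<and> {i, t} \<in> E}"
  have rec: "recursive_graph n E" by (rule G1_recursive_graph[OF assms])
  have fin: "finite E" by (rule recursive_graph_finite[OF rec])
  have "?N \<subseteq> {1..n}" using recursive_graph_subset[OF rec] by fastforce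
  then have finN: "finite ?N" by (rule finite_subset) simp
  have pair: "e = {a, b}" if "e \<in> E" "a \<in> e" "b \<in> e" "a \<noteq> b" for e a b
    using that rec unfolding recursive_graph_def by auto
  have deg: "vdegree E i - 1 = (\<Sum>e | e \<in> E \<and> i \<in> e \<and> t \<notin> e. ?w e)" if i: "i \<in> ?N" for i
  proof -
    have "{e. e \<in> E \<and> i \<in> e} = insert {i, t} {e. e \<in> E \<and> i \<in> e \<and> t \<notin> e}"
      using i pair by blast
    moreover have "card {i, t} = 2" using i by simp
    ultimately show ?thesis using fin by (simp add: vdegree_alt)
  qed
  have "{e. e \<in> E \<and> t \<notin> e \<and> (\<exists>i\<in>e. i \<noteq> t \<and> {i, t} \<in> E)}
      = (\<Union>i\<in>?N. {e. e \<in> E \<and> i \<in> e \<and> t \<notin> e})" by blast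
  then have "second_degree E t = (\<Sum>e\<in>(\<Union>i\<in>?N. {e. e \<in> E \<and> i \<in> e \<and> t \<notin> e}). ?w e)"
    unfolding second_degree_def by simp
  also have "\<dots> = (\<Sum>i\<in>?N. \<Sum>e | e \<in> E \<and> i \<in> e \<and> t \<notin> e. ?w e)"
  proof (rule sum.UNION_disjoint[OF finN])
    show "\<forall>i\<in>?N. \<forall>j\<in>?N. i \<noteq> j \<longrightarrow>
        {e. e \<in> E \<and> i \<in> e \<and> t \<notin> e} \<inter> {e. e \<in> E \<and> j \<in> e \<and> t \<notin> e} = {}"
      using recursive_graph_no_triangle[OF rec] pair by blast
  qed (use fin in auto)
  also have "\<dots> = (\<Sum>i\<in>?N. vdegree E i - 1)" using deg by simp
  finally show ?thesis .
qed

end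

theory Submission
  imports Defs
begin

text \<open>
  Attaching \<open>t\<close> proportionally to degrees amounts to picking one of \<open>2t - 1\<close> half-edges uniformly, so
  \<open>G\<^sub>1\<^sup>n\<close> is a function of \<open>n\<close> independent uniform choices. Altering one choice moves some
  edges from a common old end \<open>p\<close> to a common new end \<open>q\<close>, which changes only the second degrees of
  \<open>p\<close>, \<open>q\<close> and their neighbours. A vertex with a neighbour of second degree \<open>k\<close> has degree at most
  \<open>k + 1\<close>, so \<open>X\<^sub>n(k)\<close> changes by at most \<open>2k + 4\<close>. The Efron--Stein inequality bounds its
  variance by \<open>n (2k + 4)\<^sup>2\<close>, and Chebyshev's inequality suffices with \<open>\<phi>(n) = n\<^sup>1\<^sup>-\<^sup>\<epsilon>\<close>.
\<close>

section \<open>Variance of functions of independent, finitely supported choices\<close>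

lemma expectation_pair_pmf:
  fixes f :: "'a \<times> 'b \<Rightarrow> real"
  assumes "finite (set_pmf p)" "finite (set_pmf q)"
  shows "measure_pmf.expectation (pair_pmf p q) f =
    measure_pmf.expectation p (\<lambda>x. measure_pmf.expectation q (\<lambda>y. f (x, y)))"
  unfolding pair_pmf_def using assms
  by (simp add: pmf_expectation_bind[where A = "set_pmf p"] integral_measure_pmf[where A = "set_pmf p"]
      flip: map_pmf_def)

lemma expectation_bound:
  fixes f :: "'a \<Rightarrow> real"
  assumes "finite (set_pmf p)" "\<And>x. x \<in> set_pmf p \<Longrightarrow> f x \<le> c"
  shows "measure_pmf.expectation p f \<le> c"
proof -
  have "measure_pmf.expectation p f \<le> measure_pmf.expectation p (\<lambda>_. c)"
    using assms by (intro integral_mono_AE) (auto simp: AE_measure_pmf_iff integrable_measure_pmf_finite)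
  then show ?thesis by simp
qed

lemma abs_expectation_bound:
  fixes f :: "'a \<Rightarrow> real"
  assumes "finite (set_pmf p)" "\<And>x. x \<in> set_pmf p \<Longrightarrow> \<bar>f x\<bar> \<le> c"
  shows "\<bar>measure_pmf.expectation p f\<bar> \<le> c"
  using assms(2) by (intro order_trans[OF integral_abs_bound expectation_bound[OF assms(1)]])

text \<open>Averaging \<open>f x - f y\<close> over \<open>y\<close> puts every value of
  \<open>f\<close> within \<open>c\<close> of the mean.\<close>

lemma variance_le_oscillation:
  fixes f :: "'a \<Rightarrow> real"
  assumes "finite (set_pmf p)" "\<And>x y. x \<in> set_pmf p \<Longrightarrow> y \<in> set_pmf p \<Longrightarrow> \<bar>f x - f y\<bar> \<le> c"
  shows "measure_pmf.variance p f \<le> c\<^sup>2"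
proof (rule expectation_bound[OF assms(1)])
  fix x assume x: "x \<in> set_pmf p"
  have "\<bar>measure_pmf.expectation p (\<lambda>y. f x - f y)\<bar> \<le> c"
    using assms x by (intro abs_expectation_bound) auto
  also have "measure_pmf.expectation p (\<lambda>y. f x - f y) = f x - measure_pmf.expectation p f"
    using assms(1) by (subst Bochner_Integration.integral_diff)
      (auto simp: integrable_measure_pmf_finite)
  finally show "(f x - measure_pmf.expectation p f)\<^sup>2 \<le> c\<^sup>2"
    by (meson abs_ge_zero abs_le_square_iff order_trans abs_ge_self)
qed

text \<open>Meant for conditional distributions: with \<open>m\<close> the overall mean, it
  separates the conditional variance from the squared deviation of the conditional mean.\<close>

lemma expectation_square_shift:
  fixes f :: "'a \<Rightarrow> real"
  assumes "finite (set_pmf p)"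
  shows "measure_pmf.expectation p (\<lambda>x. (f x - m)\<^sup>2) =
    measure_pmf.variance p f + (measure_pmf.expectation p f - m)\<^sup>2"
proof -
  note [simp] = integrable_measure_pmf_finite[OF assms]
  have "measure_pmf.expectation p (\<lambda>x. (f x - m)\<^sup>2) =
     measure_pmf.expectation p (\<lambda>x. (f x)\<^sup>2 - 2 * m * f x + m\<^sup>2)"
    by (simp add: power2_diff algebra_simps)
  also have "\<dots> = measure_pmf.expectation p (\<lambda>x. (f x)\<^sup>2) - 2 * m * measure_pmf.expectation p f + m\<^sup>2"
    by simp
  finally show ?thesis
    by (subst measure_pmf.variance_eq) (simp_all add: power2_eq_square algebra_simps)
qed

text \<open>The law of total variance, conditioning on the first coordinate.\<close>

lemma variance_pair_pmf:
  fixes f :: "'a \<times> 'b \<Rightarrow> real"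
  assumes "finite (set_pmf p)" "finite (set_pmf q)"
  shows "measure_pmf.variance (pair_pmf p q) f =
    measure_pmf.expectation p (\<lambda>x. measure_pmf.variance q (\<lambda>y. f (x, y))) +
    measure_pmf.variance p (\<lambda>x. measure_pmf.expectation q (\<lambda>y. f (x, y)))"
  unfolding expectation_pair_pmf[OF assms]
  by (subst expectation_square_shift[OF assms(2)])
    (simp add: integrable_measure_pmf_finite[OF assms(1)])

text \<open>Efron--Stein with worst-case differences. One coordinate \<open>x\<close> is exposed:
  the induction hypothesis bounds the variance once it is fixed, and the conditional mean given it
  oscillates by at most \<open>c x\<close>.\<close>

lemma variance_Pi_pmf_bounded_differences:
  fixes f :: "('i \<Rightarrow> 'a) \<Rightarrow> real"
  assumes "finite I" "\<And>i. i \<in> I \<Longrightarrow> finite (set_pmf (p i))"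
    and "\<And>i u a. i \<in> I \<Longrightarrow> u \<in> set_pmf (Pi_pmf I d p) \<Longrightarrow> a \<in> set_pmf (p i) \<Longrightarrow>
      \<bar>f (u(i := a)) - f u\<bar> \<le> c i"
  shows "measure_pmf.variance (Pi_pmf I d p) f \<le> (\<Sum>i\<in>I. (c i)\<^sup>2)"
  using assms
proof (induction I arbitrary: f rule: finite_induct)
  case empty
  then show ?case by simp
next
  case (insert x F)
  let ?P = "Pi_pmf F d p"
  \<comment> \<open>The differences of \<open>f\<close> are controlled only on the support of the
    full product, so the configurations compared below must lie there.\<close>
  have upd: "u(x := y) \<in> set_pmf (Pi_pmf (insert x F) d p)"
    if "u \<in> set_pmf ?P" "y \<in> set_pmf (p x)" for u y
    using that insert.hyps by (auto simp: set_Pi_pmf PiE_dflt_def)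
  have finP: "finite (set_pmf ?P)"
    using insert by (auto simp: set_Pi_pmf)
  have finx: "finite (set_pmf (p x))" using insert.prems by auto
  define g where "g = (\<lambda>(y, u). f (u(x := y)))"
  have "measure_pmf.variance (Pi_pmf (insert x F) d p) f = measure_pmf.variance (pair_pmf (p x) ?P) g"
    using insert.hyps by (simp add: Pi_pmf_insert g_def case_prod_unfold)
  also have "\<dots> = measure_pmf.expectation (p x) (\<lambda>y. measure_pmf.variance ?P (\<lambda>u. g (y, u))) +
      measure_pmf.variance (p x) (\<lambda>y. measure_pmf.expectation ?P (\<lambda>u. g (y, u)))"
    by (rule variance_pair_pmf[OF finx finP])
  also have "\<dots> \<le> (\<Sum>i\<in>F. (c i)\<^sup>2) + (c x)\<^sup>2"
  proof (intro add_mono)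
    show "measure_pmf.expectation (p x) (\<lambda>y. measure_pmf.variance ?P (\<lambda>u. g (y, u))) \<le> (\<Sum>i\<in>F. (c i)\<^sup>2)"
    proof (rule expectation_bound[OF finx])
      fix y assume y: "y \<in> set_pmf (p x)"
      show "measure_pmf.variance ?P (\<lambda>u. g (y, u)) \<le> (\<Sum>i\<in>F. (c i)\<^sup>2)"
      proof (rule insert.IH)
        fix i u a assume i: "i \<in> F" and u: "u \<in> set_pmf ?P" and a: "a \<in> set_pmf (p i)"
        have ix: "i \<noteq> x" using i insert.hyps by auto
        show "\<bar>g (y, u(i := a)) - g (y, u)\<bar> \<le> c i"
          using insert.prems(2)[of i "u(x := y)" a] i a upd[OF u y]
          unfolding g_def prod.case fun_upd_twist[OF ix] by blast
      qed (use insert.prems in auto)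
    qed
    show "measure_pmf.variance (p x) (\<lambda>y. measure_pmf.expectation ?P (\<lambda>u. g (y, u))) \<le> (c x)\<^sup>2"
    proof (rule variance_le_oscillation[OF finx])
      fix y z assume y: "y \<in> set_pmf (p x)" and z: "z \<in> set_pmf (p x)"
      have "\<bar>measure_pmf.expectation ?P (\<lambda>u. g (y, u) - g (z, u))\<bar> \<le> c x"
      proof (rule abs_expectation_bound[OF finP])
        fix u assume u: "u \<in> set_pmf ?P"
        \<comment> \<open>\<open>u(x := y)\<close> is a one-coordinate update of
          \<open>u(x := z)\<close>.\<close>
        show "\<bar>g (y, u) - g (z, u)\<bar> \<le> c x"
          using insert.prems(2)[of x "u(x := z)" y] upd[OF u z] y
          unfolding g_def prod.case fun_upd_upd by blast
      qed
      then show "\<bar>measure_pmf.expectation ?P (\<lambda>u. g (y, u)) - measure_pmf.expectation ?P (\<lambda>u. g (z, u))\<bar> \<le> c x"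
        by (simp add: integrable_measure_pmf_finite[OF finP])
    qed
  qed
  finally show ?case using insert.hyps by (simp add: add.commute)
qed

section \<open>Graphs determined by a parent function\<close>

definition parent_graph :: "nat \<Rightarrow> (nat \<Rightarrow> nat) \<Rightarrow> graph" where
  "parent_graph n f = (\<lambda>t. {t, f t}) ` {1..n}"

lemma recursive_graph_parent_graph:
  "(\<And>t. t \<in> {1..n} \<Longrightarrow> f t \<in> {1..t}) \<Longrightarrow> recursive_graph n (parent_graph n f)"
  unfolding recursive_graph_def parent_graph_def by blast

lemma parent_graph_Suc:
  "parent_graph (Suc n) f = insert {Suc n, f (Suc n)} (parent_graph n f)"
  by (auto simp: parent_graph_def atLeastAtMostSuc_conv)

lemma edge_parent_graph_iff:
  "{i, t} \<in> parent_graph n f \<longleftrightarrow> i \<in> {1..n} \<and> f i = t \<or> t \<in> {1..n} \<and> f t = i"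
  unfolding parent_graph_def by (auto simp: doubleton_eq_iff)

text \<open>The \<open>Suc\<close> is the edge emitted by \<open>s\<close>. A loop at
  \<open>s\<close> is counted there and again in the set, which gives its weight 2.\<close>

lemma vdegree_parent_graph:
  assumes "\<And>t. t \<in> {1..n} \<Longrightarrow> f t \<in> {1..t}" "s \<in> {1..n}"
  shows "vdegree (parent_graph n f) s = Suc (card {t \<in> {1..n}. f t = s})"
proof -
  let ?e = "\<lambda>t. {t, f t}"
  \<comment> \<open>Since \<open>f t\<close> is at most \<open>t\<close>, the larger end of an edge
    identifies its index.\<close>
  have inj: "inj_on ?e {1..n}"
  proof (rule inj_onI)
    fix a b assume "a \<in> {1..n}" "b \<in> {1..n}" "?e a = ?e b"
    then show "a = b" using assms(1)[of a] assms(1)[of b] by (auto simp: doubleton_eq_iff)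
  qed
  let ?A = "{t \<in> {1..n}. f t = s}"
  have "{e \<in> parent_graph n f. s \<in> e} = ?e ` ({s} \<union> ?A)"
    using assms(2) by (auto simp: parent_graph_def)
  moreover have "{e \<in> parent_graph n f. e = {s}} = ?e ` ({s} \<inter> ?A)"
    using assms(2) by (auto simp: parent_graph_def)
  moreover have "card (?e ` B) = card B" if "B \<subseteq> {1..n}" for B
    using inj that by (meson card_image inj_on_subset)
  moreover have "{s} \<union> ?A \<subseteq> {1..n}" "{s} \<inter> ?A \<subseteq> {1..n}" using assms(2) by auto
  ultimately have "vdegree (parent_graph n f) s = card ({s} \<union> ?A) + card ({s} \<inter> ?A)"
    unfolding vdegree_def by presburger
  then show ?thesis using card_Un_Int[of "{s}" ?A] by simp
qed

section \<open>Independent uniform choices that generate \<open>G1\<close>\<close>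

text \<open>A slot \<open>(s, False)\<close> of vertex \<open>t\<close> sends the edge of \<open>t\<close> to \<open>s\<close>; a slot \<open>(s, True)\<close> copies the
  end of the edge emitted by \<open>s\<close>. So a vertex \<open>s < t\<close> is hit by as many slots as its current degree.\<close>

definition slots :: "nat \<Rightarrow> (nat \<times> bool) set" where
  "slots t = {1..t} \<times> {False} \<union> {1..<t} \<times> {True}"

text \<open>The guard \<open>fst (u t) < t\<close> makes the recursion terminate for arbitrary
  \<open>u\<close>; every copying slot in \<open>slots t\<close> satisfies it.\<close>

function target :: "(nat \<Rightarrow> nat \<times> bool) \<Rightarrow> nat \<Rightarrow> nat" where
  "target u t = (if snd (u t) \<and> fst (u t) < t then target u (fst (u t)) else fst (u t))"
  by auto
termination by (relation "Wellfounded.measure snd") auto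

declare target.simps [simp del]

lemma card_slots: "card (slots t) = 2 * t - 1"
  unfolding slots_def by (subst card_Un_disjoint) auto

lemma finite_slots [simp]: "finite (slots t)"
  by (simp add: slots_def)

lemma slots_nonempty [simp]: "t \<ge> 1 \<Longrightarrow> slots t \<noteq> {}"
  by (auto simp: slots_def)

lemma target_cong: "(\<And>s. s \<le> t \<Longrightarrow> u s = v s) \<Longrightarrow> target u t = target v t"
proof (induction t rule: less_induct)
  case (less t)
  then show ?case by (subst (1 2) target.simps) auto
qed

lemma target_range:
  assumes "\<And>t. t \<in> {1..n} \<Longrightarrow> u t \<in> slots t" "t \<in> {1..n}"
  shows "target u t \<in> {1..t}"
  using assms(2)
proof (induction t rule: less_induct)
  case (less t)
  then have "u t \<in> slots t" using assms(1) by auto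
  then show ?case using less.IH[of "fst (u t)"] less.prems
    by (subst target.simps) (auto simp: slots_def)
qed

text \<open>Redirecting edge \<open>t\<close> carries along exactly the edges copying it, directly or indirectly;
  all of them move from the old end of edge \<open>t\<close> to the new one.\<close>

lemma target_upd:
  "target (u(t := a)) s = target u s \<or>
   target u s = target u t \<and> target (u(t := a)) s = target (u(t := a)) t"
proof (induction s rule: less_induct)
  case (less s)
  show ?case
  proof (cases "s = t")
    case False
    let ?r = "fst (u s)"
    show ?thesis
    proof (cases "snd (u s) \<and> ?r < s")
      case True
      then have "target u s = target u ?r" "target (u(t := a)) s = target (u(t := a)) ?r"
        using False by (simp_all add: target.simps[of _ s])
      then show ?thesis using less.IH[of ?r] True by metis
    next
      case nocopy: False
      then have "target u s = ?r" "target (u(t := a)) s = ?r"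
        using False by (subst target.simps, auto)+
      then show ?thesis by metis
    qed
  qed simp
qed

definition choices :: "nat \<Rightarrow> (nat \<Rightarrow> nat \<times> bool) pmf" where
  "choices n = Pi_pmf {1..n} (0, False) (\<lambda>t. pmf_of_set (slots t))"

lemma set_pmf_choices:
  "u \<in> set_pmf (choices n) \<Longrightarrow> t \<in> {1..n} \<Longrightarrow> u t \<in> slots t"
  unfolding choices_def by (auto simp: set_Pi_pmf PiE_dflt_def)

lemma choices_Suc:
  "choices (Suc n) = bind_pmf (choices n) (\<lambda>u. map_pmf (\<lambda>a. u(Suc n := a)) (pmf_of_set (slots (Suc n))))"
proof -
  have "{1..Suc n} = insert (Suc n) {1..n}" by auto
  then show ?thesis
    unfolding choices_def map_pmf_def
    \<comment> \<open>\<open>Pi_pmf_insert'\<close> draws the new coordinate first, so the two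
      independent draws are exchanged.\<close>
    by (subst bind_commute_pmf) (simp add: Pi_pmf_insert' fun_upd_def)
qed

text \<open>Count the slots of \<open>Suc n\<close> that lead to \<open>s\<close>. For
  \<open>s\<close> in \<open>{1..n}\<close> there is one direct slot and one copying slot per edge
  ending at \<open>s\<close>, together the degree of \<open>s\<close>; for \<open>s = Suc n\<close>
  only the direct slot remains.\<close>

lemma attach_parent_graph:
  assumes u: "\<And>t. t \<in> {1..n} \<Longrightarrow> u t \<in> slots t"
  shows "attach (Suc n) (parent_graph n (target u)) =
    map_pmf (\<lambda>a. target (u(Suc n := a)) (Suc n)) (pmf_of_set (slots (Suc n)))"
proof (rule pmf_eqI)
  fix s
  let ?g = "\<lambda>a. target (u(Suc n := a)) (Suc n)"
  have g: "?g (r, b) = (if b \<and> r < Suc n then target u r else r)" for r b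
    by (subst target.simps) (auto intro: target_cong)
  have rng: "target u t \<in> {1..t}" if "t \<in> {1..n}" for t
    using target_range[OF u that] .
  have "slots (Suc n) \<inter> ?g -` {s} =
      (if 1 \<le> s \<and> s \<le> Suc n then {(s, False)} else {}) \<union> {t \<in> {1..n}. target u t = s} \<times> {True}"
    by (auto simp: slots_def g)
  also have "card \<dots> = (if 1 \<le> s \<and> s \<le> Suc n then 1 else 0) + card {t \<in> {1..n}. target u t = s}"
    by (subst card_Un_disjoint) (auto simp: card_cartesian_product)
  finally have card: "card (slots (Suc n) \<inter> ?g -` {s}) = \<dots>" .
  have "{t \<in> {1..n}. target u t = s} = {}" if "s = 0 \<or> s > n"
    using rng that by fastforce
  then have "real (card (slots (Suc n) \<inter> ?g -` {s})) =
    (if 1 \<le> s \<and> s < Suc n then real (vdegree (parent_graph n (target u)) s)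
     else if s = Suc n then 1 else 0)"
    unfolding card using vdegree_parent_graph[of n "target u" s] rng by auto
  then show "pmf (attach (Suc n) (parent_graph n (target u))) s = pmf (map_pmf ?g (pmf_of_set (slots (Suc n)))) s"
    using pmf_attach[OF recursive_graph_parent_graph[of n "target u"]] rng
    by (simp add: pmf_map measure_pmf_of_set card_slots)
qed

text \<open>Brings the separately defined \<open>G1 1\<close> under the general recursion: vertex 1
  has a single slot, so its loop is forced.\<close>

lemma G1_Suc:
  "G1 (Suc n) = bind_pmf (G1 n) (\<lambda>E. map_pmf (\<lambda>i. insert {Suc n, i} E) (attach (Suc n) E))"
proof (cases n)
  case 0
  have "slots 1 = {(1, False)}" by (auto simp: slots_def)
  then have "attach 1 {} = return_pmf 1"
    using attach_parent_graph[of 0 "\<lambda>_. (0, False)"]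
    by (simp add: parent_graph_def pmf_of_set_singleton target.simps)
  then show ?thesis using 0 by (simp add: bind_return_pmf)
qed simp

lemma G1_eq_choices: "G1 n = map_pmf (\<lambda>u. parent_graph n (target u)) (choices n)"
proof (induction n)
  case 0
  then show ?case by (simp add: choices_def parent_graph_def)
next
  case (Suc n)
  \<comment> \<open>The choice made at \<open>Suc n\<close> is invisible to all earlier
    edges.\<close>
  have pg: "parent_graph n (target (u(Suc n := a))) = parent_graph n (target u)" for u a
    unfolding parent_graph_def by (intro image_cong refl) (auto intro: target_cong)
  show ?case
    unfolding G1_Suc Suc choices_Suc map_bind_pmf bind_map_pmf pmf.map_comp
    by (intro bind_pmf_cong refl, subst attach_parent_graph)
      (auto dest: set_pmf_choices simp: pmf.map_comp o_def parent_graph_Suc pg)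
qed

section \<open>Effect of one altered choice on the second degrees\<close>

lemma second_degree_parent_graph:
  assumes "u \<in> set_pmf (choices n)"
  shows "second_degree (parent_graph n (target u)) t =
    (\<Sum>i | i \<noteq> t \<and> {i, t} \<in> parent_graph n (target u). card {s \<in> {1..n}. target u s = i})"
proof -
  have rng: "target u s \<in> {1..s}" if "s \<in> {1..n}" for s
    using target_range that set_pmf_choices[OF assms] by blast
  have G: "parent_graph n (target u) \<in> set_pmf (G1 n)" using assms by (auto simp: G1_eq_choices)
  show ?thesis
    unfolding second_degree_alt[OF G]
  proof (intro sum.cong refl)
    fix i assume "i \<in> {i. i \<noteq> t \<and> {i, t} \<in> parent_graph n (target u)}"
    then have "i \<in> {1..n}" using rng by (fastforce simp: edge_parent_graph_iff)
    \<comment> \<open>The subtracted \<open>1\<close> cancels the edge emitted by \<open>i\<close>,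
      leaving the edges that end at \<open>i\<close>.\<close>
    then show "vdegree (parent_graph n (target u)) i - 1 = card {s \<in> {1..n}. target u s = i}"
      using vdegree_parent_graph[of n "target u" i] rng by simp
  qed
qed

text \<open>If such a \<open>t\<close> exists, the number of edges ending at \<open>p\<close> is one
  summand of the second degree of \<open>t\<close>, hence at most \<open>k\<close>. Every neighbour
  of \<open>p\<close> emits one of these edges or is the target of \<open>p\<close>.\<close>

lemma card_second_degree_neighbours:
  assumes u: "u \<in> set_pmf (choices n)"
  shows "card {t. t \<noteq> p \<and> {p, t} \<in> parent_graph n (target u) \<and>
    second_degree (parent_graph n (target u)) t = k} \<le> Suc k"
proof -
  let ?f = "target u" let ?C = "{s \<in> {1..n}. ?f s = p}"
  define N where "N = {t. t \<noteq> p \<and> {p, t} \<in> parent_graph n ?f \<and>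
    second_degree (parent_graph n ?f) t = k}"
  show ?thesis
  proof (cases "N = {}")
    case False
    then obtain t where t: "t \<noteq> p" "{p, t} \<in> parent_graph n ?f"
      "second_degree (parent_graph n ?f) t = k"
      by (auto simp: N_def)
    have "{i. i \<noteq> t \<and> {i, t} \<in> parent_graph n ?f} \<subseteq> {1..n} \<union> ?f ` {1..n}"
      by (auto simp: edge_parent_graph_iff)
    then have "finite {i. i \<noteq> t \<and> {i, t} \<in> parent_graph n ?f}"
      by (rule finite_subset) simp
    then have "card ?C \<le> (\<Sum>i | i \<noteq> t \<and> {i, t} \<in> parent_graph n ?f. card {s \<in> {1..n}. ?f s = i})"
      using t by (intro member_le_sum) auto
    also have "\<dots> = k" using second_degree_parent_graph[OF u, of t] t(3) by simp
    finally have "card ?C \<le> k" .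
    moreover have "N \<subseteq> insert (?f p) ?C" by (auto simp: N_def edge_parent_graph_iff)
    then have "card N \<le> card (insert (?f p) ?C)" by (intro card_mono) auto
    moreover have "card (insert (?f p) ?C) \<le> Suc (card ?C)" by (simp add: card_insert_if)
    ultimately show ?thesis unfolding N_def by linarith
  qed (simp flip: N_def)
qed

lemma second_degree_upd:
  assumes u: "u \<in> set_pmf (choices n)" "v \<in> set_pmf (choices n)"
    and move: "\<And>s. target v s = target u s \<or> target u s = p \<and> target v s = q"
    and t: "t \<noteq> p" "t \<noteq> q" "{p, t} \<notin> parent_graph n (target u)" "{q, t} \<notin> parent_graph n (target u)"
  shows "second_degree (parent_graph n (target v)) t = second_degree (parent_graph n (target u)) t"
proof -
  \<comment> \<open>So the edge emitted by \<open>t\<close> stays in place, as only edges ending at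
    \<open>p\<close> move.\<close>
  have pu: "target u t \<noteq> p" if "t \<in> {1..n}"
    using t that by (auto simp: edge_parent_graph_iff)
  have edge: "{i, t} \<in> parent_graph n (target v) \<longleftrightarrow> {i, t} \<in> parent_graph n (target u)" for i
    using move[of i] move[of t] t pu by (auto simp: edge_parent_graph_iff)
    have "{s \<in> {1..n}. target v s = i} = {s \<in> {1..n}. target u s = i}"
      if "{i, t} \<in> parent_graph n (target u)" for i
    proof -
      \<comment> \<open>Only \<open>p\<close> and \<open>q\<close> can lose or gain incoming edges,
        and neither is a neighbour of \<open>t\<close>.\<close>
      have "i \<noteq> p" "i \<noteq> q" using that t by auto
      then show ?thesis using move by metis
    qed
    then show ?thesis unfolding second_degree_parent_graph[OF u(1)] second_degree_parent_graph[OF u(2)] edge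
      by (intro sum.cong) auto
qed

text \<open>Vertices leaving the count are \<open>p\<close>, \<open>q\<close>, or old neighbours of
  these with old second degree \<open>k\<close>: at most \<open>2 + 2 * (k + 1)\<close>. Working in
  the old graph suffices for this one-sided bound; the converse follows by exchanging
  \<open>u\<close> and \<open>v\<close>.\<close>

lemma X_parent_graph_diff:
  assumes u: "u \<in> set_pmf (choices n)" "v \<in> set_pmf (choices n)"
    and move: "\<And>s. target v s = target u s \<or> target u s = p \<and> target v s = q"
  shows "X n k (parent_graph n (target u)) \<le> X n k (parent_graph n (target v)) + (2 * k + 4)"
proof -
  let ?S = "\<lambda>w. {t \<in> {1..n}. second_degree (parent_graph n (target w)) t = k}"
  let ?N = "\<lambda>r. {t. t \<noteq> r \<and> {r, t} \<in> parent_graph n (target u) \<and>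
    second_degree (parent_graph n (target u)) t = k}"
  have fin: "finite (?N r)" for r
    by (rule finite_subset[of _ "{1..n} \<union> target u ` {1..n}"]) (auto simp: edge_parent_graph_iff)
  have "?S u \<subseteq> ?S v \<union> ({p, q} \<union> (?N p \<union> ?N q))"
    using second_degree_upd[OF u move] by auto
  then have "card (?S u) \<le> card (?S v \<union> ({p, q} \<union> (?N p \<union> ?N q)))"
    by (rule card_mono[rotated]) (simp add: fin)
  also have "\<dots> \<le> card (?S v) + (card {p, q} + (card (?N p) + card (?N q)))"
    by (intro order_trans[OF card_Un_le] add_mono order_refl)
  also have "\<dots> \<le> card (?S v) + (2 + (Suc k + Suc k))"
    using card_second_degree_neighbours[OF u(1)] by (intro add_mono) (auto simp: card_insert_if)
  finally show ?thesis by (simp add: X_def)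
qed

lemma variance_X: "measure_pmf.variance (G1 n) (\<lambda>E. real (X n k E)) \<le> real n * (2 * real k + 4)\<^sup>2"
proof -
  let ?Y = "\<lambda>u. real (X n k (parent_graph n (target u)))"
  have "measure_pmf.variance (choices n) ?Y \<le> (\<Sum>i\<in>{1..n}. (2 * real k + 4)\<^sup>2)"
    unfolding choices_def
  proof (rule variance_Pi_pmf_bounded_differences)
    fix i u a
    assume i: "i \<in> {1..n}" and "u \<in> set_pmf (Pi_pmf {1..n} (0, False) (\<lambda>t. pmf_of_set (slots t)))"
      and a: "a \<in> set_pmf (pmf_of_set (slots i))"
    then have u: "u \<in> set_pmf (choices n)" by (simp add: choices_def)
    let ?v = "u(i := a)"
    have v: "?v \<in> set_pmf (choices n)"
      using u i a by (auto simp: choices_def set_Pi_pmf PiE_dflt_def)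
    have "X n k (parent_graph n (target u)) \<le> X n k (parent_graph n (target ?v)) + (2 * k + 4)"
      by (rule X_parent_graph_diff[OF u v target_upd])
    moreover have "X n k (parent_graph n (target ?v)) \<le> X n k (parent_graph n (target u)) + (2 * k + 4)"
      \<comment> \<open>Resetting coordinate \<open>i\<close> of \<open>?v\<close> to
        \<open>u i\<close> recovers \<open>u\<close>, so the move can be read backwards.\<close>
      using target_upd[of ?v i "u i"] by (intro X_parent_graph_diff[OF v u]) (simp only: fun_upd_upd fun_upd_triv)
    ultimately show "\<bar>?Y ?v - ?Y u\<bar> \<le> 2 * real k + 4" by linarith
  qed auto
  then show ?thesis by (simp add: G1_eq_choices)
qed

section \<open>Chebyshev's inequality and the exponents\<close>

lemma prob_X_deviation:
  assumes "1 \<le> k" "a > 0"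
  shows "measure_pmf.prob (G1 n) {E. \<bar>real (X n k E) - M2 n k\<bar> \<ge> a} \<le> 36 * real n * (real k)\<^sup>2 / a\<^sup>2"
proof -
  have "finite (set_pmf (G1 n))"
    unfolding G1_eq_choices choices_def set_map_pmf
    by (intro finite_imageI) (auto simp: set_Pi_pmf intro!: finite_PiE_dflt)
  then have "measure_pmf.prob (G1 n) {E. \<bar>real (X n k E) - M2 n k\<bar> \<ge> a} \<le>
    measure_pmf.variance (G1 n) (\<lambda>E. real (X n k E)) / a\<^sup>2"
    unfolding M2_def
    using measure_pmf.Chebyshev_inequality[of "\<lambda>E. real (X n k E)" "G1 n" a] assms(2)
    by (simp add: integrable_measure_pmf_finite)
  also have "\<dots> \<le> real n * (2 * real k + 4)\<^sup>2 / a\<^sup>2"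
    by (intro divide_right_mono variance_X) simp
  \<comment> \<open>For \<open>k \<ge> 1\<close> the constant 4 is absorbed into
    \<open>4 * k\<close>; this is the source of 36.\<close>
  also have "(2 * real k + 4)\<^sup>2 \<le> (6 * real k)\<^sup>2"
    using assms(1) by (intro power_mono) auto
  then have "real n * (2 * real k + 4)\<^sup>2 / a\<^sup>2 \<le> 36 * real n * (real k)\<^sup>2 / a\<^sup>2"
    using mult_left_mono[of "(2 * real k + 4)\<^sup>2" "36 * (real k)\<^sup>2" "real n"]
    by (intro divide_right_mono) (auto simp: power_mult_distrib mult_ac)
  finally show ?thesis .
qed

theorem theorem3:
  fixes \<epsilon> :: real
  assumes "\<epsilon> > 0"
  shows "\<exists>\<phi> :: nat \<Rightarrow> real. \<phi> \<in> o(\<lambda>n. real n) \<and>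
    (\<lambda>n. Max (insert 0
       ((\<lambda>k. measure_pmf.prob (G1 n) {E. \<bar>real (X n k E) - M2 n k\<bar> \<ge> \<phi> n / (real k)\<^sup>2})
         ` {k. 1 \<le> k \<and> real k \<le> real n powr (1/6 - \<epsilon>)})))
    \<longlonglongrightarrow> 0"
proof (intro exI[of _ "\<lambda>n. real n powr (1 - \<epsilon>)"] conjI)
  let ?\<phi> = "\<lambda>n :: nat. real n powr (1 - \<epsilon>)"
  let ?K = "\<lambda>n :: nat. {k :: nat. 1 \<le> k \<and> real k \<le> real n powr (1/6 - \<epsilon>)}"
  let ?P = "\<lambda>n k. measure_pmf.prob (G1 n) {E. \<bar>real (X n k E) - M2 n k\<bar> \<ge> ?\<phi> n / (real k)\<^sup>2}"
  have neg: "(\<lambda>n. real n powr (- c)) \<longlonglongrightarrow> 0" if "c > 0" for c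
    using that by (intro tendsto_neg_powr filterlim_real_sequentially) auto
  show "?\<phi> \<in> o(\<lambda>n. real n)"
  proof (rule smalloI_tendsto)
    show "(\<lambda>n. ?\<phi> n / real n) \<longlonglongrightarrow> 0"
      using neg[OF assms]
    proof (rule Lim_transform_eventually)
      show "\<forall>\<^sub>F n in sequentially. real n powr (- \<epsilon>) = ?\<phi> n / real n"
        using eventually_gt_at_top[of 0] by eventually_elim (simp add: powr_diff powr_minus_divide)
    qed
    show "\<forall>\<^sub>F n in sequentially. real n \<noteq> 0"
      using eventually_gt_at_top[of 0] by eventually_elim simp
  qed
  have finK: "finite (?K n)" for n
  proof (rule finite_subset)
    show "?K n \<subseteq> {..nat \<lceil>real n powr (1/6 - \<epsilon>)\<rceil>}" by (auto simp: le_nat_iff) linarith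
  qed simp
  \<comment> \<open>With threshold \<open>?\<phi> n / k^2\<close>, Chebyshev gives
    \<open>36 * n * k^6 / (?\<phi> n)^2\<close>. The range of \<open>k\<close> bounds
    \<open>k^6\<close> by \<open>n\<close> to the power \<open>1 - 6 * \<epsilon>\<close>, and
    \<open>1 + (1 - 6 * \<epsilon>) - 2 * (1 - \<epsilon>) = - 4 * \<epsilon>\<close>; hence the
    role of 1/6 and the choice of \<open>?\<phi>\<close>.\<close>
  have bound: "?P n k \<le> 36 * real n powr (- 4 * \<epsilon>)" if n: "n > 0" and k: "k \<in> ?K n" for n k
  proof -
    have "?P n k \<le> 36 * real n * (real k)\<^sup>2 / (?\<phi> n / (real k)\<^sup>2)\<^sup>2"
      using n k by (intro prob_X_deviation) auto
    also have "\<dots> = 36 * real n * real k ^ 6 / (?\<phi> n)\<^sup>2"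
      using k by (simp add: field_simps flip: power_add power_mult)
    also have "\<dots> \<le> 36 * real n * (real n powr (1/6 - \<epsilon>)) ^ 6 / (?\<phi> n)\<^sup>2"
      using k by (intro divide_right_mono mult_left_mono power_mono) auto
    also have "\<dots> = 36 * (real n powr 1 * real n powr (6 * (1/6 - \<epsilon>)) / real n powr (2 * (1 - \<epsilon>)))"
      using n by (simp add: powr_power mult.commute)
    also have "\<dots> = 36 * real n powr (- 4 * \<epsilon>)"
      unfolding powr_add[symmetric] powr_diff[symmetric] by (simp add: algebra_simps)
    finally show ?thesis .
  qed
  show "(\<lambda>n. Max (insert 0 (?P n ` ?K n))) \<longlonglongrightarrow> 0"
  proof (rule tendsto_sandwich)
    show "\<forall>\<^sub>F n in sequentially. 0 \<le> Max (insert 0 (?P n ` ?K n))"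
      using finK by (intro always_eventually allI Max_ge) auto
    show "\<forall>\<^sub>F n in sequentially. Max (insert 0 (?P n ` ?K n)) \<le> 36 * real n powr (- 4 * \<epsilon>)"
      using eventually_gt_at_top[of 0]
    proof eventually_elim
      case (elim n)
      then show ?case using finK bound by (intro Max.boundedI) auto
    qed
    show "(\<lambda>n. 36 * real n powr (- 4 * \<epsilon>)) \<longlonglongrightarrow> 0"
      using neg[of "4 * \<epsilon>"] assms by (auto intro!: tendsto_mult_right_zero)
  qed simp
qed

end
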